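(* Let $F=\langle W,R,S\rangle$ be a finite $\mathbf{IL}$-frame. Then $F\models\mathsf{B}$ (that is, $F\models (A\rhd B)\to (A\wedge\Box C\rhd B\wedge\Box C)$ for all $A\in\mathsf{ES}_2$ and all modal interpretability formulas $B,C$) if and only if $F\models\mathcal{C}_{\mathsf B}$, i.e. if and only if there is a $\mathsf B$-simulation $\mathcal S$ on $F$ such that for all $x,y\in W$, $$xRy\to\exists y'\,\big(yS_xy'\wedge\mathcal S(y,y')\wedge\forall d,e\,(y'S_xd\wedge dRe\to yRe)\big).$$
   Context: Modal interpretability formulas $\mathcal A$ are built from propositional variables and $\bot$ using $\wedge,\to$, a unary modality $\Box$ and a binary modality $\rhd$; $\neg,\vee,\top,\Diamond=\neg\Box\neg$ are the usual abbreviations. $\rhd$ binds weaker than $\wedge,\vee$ and stronger than $\to$. The class $\mathsf{ES}_2$ of formulas is given by the grammar $\mathsf{ES}_2 ::= \Box\mathcal A \mid \neg\Box\mathcal A\mid \mathsf{ES}_2\wedge\mathsf{ES}_2\mid\mathsf{ES}_2\vee\mathsf{ES}_2\mid\neg(\mathsf{ES}_2\rhd\mathcal A)$, where $\mathcal A$ ranges over all modal interpretability formulas. An $\mathbf{IL}$-frame (Veltman frame) is a triple $\langle W,R,S\rangle$ with $W$ nonempty, $R$ a binary relation on $W$, and $S=(S_x)_{x\in W}$ a family of binary relations on $W$ such that: (1) $R$ is transitive and conversely well-founded; (2) $yS_xz\Rightarrow xRy$ and $xRz$; (3) $xRy\Rightarrow yS_xy$; (4) $xRyRz\Rightarrow yS_xz$;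 (5) $uS_xvS_xw\Rightarrow uS_xw$. An $\mathbf{IL}$-model adds a forcing relation $\Vdash$ between worlds and propositional variables, extended to boolean connectives as usual and by: $w\Vdash\Box A$ iff $v\Vdash A$ for all $v$ with $wRv$; $w\Vdash A\rhd B$ iff for all $u$ with $wRu$ and $u\Vdash A$ there is $v$ with $uS_wv$ and $v\Vdash B$. $F\models A$ means that $A$ is forced at every world of $F$ under every valuation. Notation: $x{\uparrow}=\{y\mid xRy\}$ and $yS_x{\uparrow}=\{z\mid yS_xz\}$. A $\mathsf B$-simulation on a frame is a binary relation $\mathcal S$ on $W$ such that: (1) $\mathcal S(x,x')\to x{\uparrow}=x'{\uparrow}$; (2) $\mathcal S(x,x')\wedge xRy\to\exists y'\,(yS_xy'\wedge\mathcal S(y,y')\wedge y'S_{x'}{\uparrow}\subseteq yS_x{\uparrow})$. *)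

theory Defs
  imports Main
begin

datatype fm =
    Var nat
  | Bot
  | And fm fm
  | Imp fm fm
  | Box fm
  | Rhd fm fm

abbreviation Neg :: "fm \<Rightarrow> fm" where
  "Neg A \<equiv> Imp A Bot"

abbreviation Or :: "fm \<Rightarrow> fm \<Rightarrow> fm" where
  "Or A B \<equiv> Imp (Neg A) B"

inductive ES2 :: "fm \<Rightarrow> bool" where
  ES2_Box: "ES2 (Box A)"
| ES2_NegBox: "ES2 (Neg (Box A))"
| ES2_And: "ES2 A \<Longrightarrow> ES2 B \<Longrightarrow> ES2 (And A B)"
| ES2_Or: "ES2 A \<Longrightarrow> ES2 B \<Longrightarrow> ES2 (Or A B)"
| ES2_NegRhd: "ES2 A \<Longrightarrow> ES2 (Neg (Rhd A B))"

text \<open>Worlds form a carrier set \<open>W\<close> inside an arbitrary type. The family \<open>S\<close> is a total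
  function, but only its values at worlds in \<open>W\<close> are constrained or used.\<close>

locale il_frame =
  fixes W :: "'w set" and R :: "'w rel" and S :: "'w \<Rightarrow> 'w rel"
  assumes W_nonempty: "W \<noteq> {}"
    and R_carrier: "R \<subseteq> W \<times> W"
    and S_carrier: "x \<in> W \<Longrightarrow> S x \<subseteq> W \<times> W"
    and R_trans: "trans R"
    and R_conversely_wf: "wf (R\<inverse>)"
    and S_dom: "x \<in> W \<Longrightarrow> (y, z) \<in> S x \<Longrightarrow> (x, y) \<in> R \<and> (x, z) \<in> R"
    and S_refl: "(x, y) \<in> R \<Longrightarrow> (y, y) \<in> S x"
    and R_sub_S: "(x, y) \<in> R \<Longrightarrow> (y, z) \<in> R \<Longrightarrow> (y, z) \<in> S x"
    and S_trans: "x \<in> W \<Longrightarrow> (u, v) \<in> S x \<Longrightarrow> (v, w) \<in> S x \<Longrightarrow> (u, w) \<in> S x"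

primrec forces ::
  "'w rel \<Rightarrow> ('w \<Rightarrow> 'w rel) \<Rightarrow> ('w \<Rightarrow> nat \<Rightarrow> bool) \<Rightarrow> 'w \<Rightarrow> fm \<Rightarrow> bool" where
  "forces R S V w (Var p) \<longleftrightarrow> V w p"
| "forces R S V w Bot \<longleftrightarrow> False"
| "forces R S V w (And A B) \<longleftrightarrow> forces R S V w A \<and> forces R S V w B"
| "forces R S V w (Imp A B) \<longleftrightarrow> (forces R S V w A \<longrightarrow> forces R S V w B)"
| "forces R S V w (Box A) \<longleftrightarrow> (\<forall>v. (w, v) \<in> R \<longrightarrow> forces R S V v A)"
| "forces R S V w (Rhd A B) \<longleftrightarrow>
     (\<forall>u. (w, u) \<in> R \<and> forces R S V u A \<longrightarrow> (\<exists>v. (u, v) \<in> S w \<and> forces R S V v B))"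

definition frame_valid :: "'w set \<Rightarrow> 'w rel \<Rightarrow> ('w \<Rightarrow> 'w rel) \<Rightarrow> fm \<Rightarrow> bool" where
  "frame_valid W R S A \<longleftrightarrow> (\<forall>V. \<forall>w\<in>W. forces R S V w A)"

definition schema_B :: "fm set" where
  "schema_B = {Imp (Rhd A B) (Rhd (And A (Box C)) (And B (Box C))) | A B C. ES2 A}"

definition B_simulation :: "'w set \<Rightarrow> 'w rel \<Rightarrow> ('w \<Rightarrow> 'w rel) \<Rightarrow> 'w rel \<Rightarrow> bool" where
  "B_simulation W R S Z \<longleftrightarrow>
     Z \<subseteq> W \<times> W \<and>
     (\<forall>x x'. (x, x') \<in> Z \<longrightarrow> R `` {x} = R `` {x'}) \<and>
     (\<forall>x x' y. (x, x') \<in> Z \<and> (x, y) \<in> R \<longrightarrow>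
        (\<exists>y'. (y, y') \<in> S x \<and> (y, y') \<in> Z \<and> S x' `` {y'} \<subseteq> S x `` {y}))"

definition frame_condition_B :: "'w set \<Rightarrow> 'w rel \<Rightarrow> ('w \<Rightarrow> 'w rel) \<Rightarrow> bool" where
  "frame_condition_B W R S \<longleftrightarrow>
     (\<exists>Z. B_simulation W R S Z \<and>
        (\<forall>x\<in>W. \<forall>y\<in>W. (x, y) \<in> R \<longrightarrow>
           (\<exists>y'. (y, y') \<in> S x \<and> (y, y') \<in> Z \<and>
              (\<forall>d e. (y', d) \<in> S x \<and> (d, e) \<in> R \<longrightarrow> (y, e) \<in> R))))"

end

theory Submission
  imports Defs
begin

text \<open>
  A \<open>B\<close>-simulation is to \<open>ES2\<close> formulas what a simulation is to positive existential modal
  formulas: truth of an \<open>ES2\<close> formula is carried from \<open>x\<close> to \<open>x'\<close> whenever \<open>x\<close> and \<open>x'\<close> are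
  related (\<open>ES2_preserved_by_B_simulation\<close>). This gives the direction from the frame condition
  to validity: if \<open>y\<close> satisfies \<open>A \<and> \<box>C\<close>, move to the world \<open>y'\<close> supplied by the condition, where
  \<open>A\<close> still holds; the \<open>B\<close>-world that \<open>A \<rhd> B\<close> provides above \<open>y'\<close> sees only successors of \<open>y\<close>,
  hence satisfies \<open>\<box>C\<close>.

  Conversely, on a finite frame there is a valuation under which every set of worlds is definable
  (\<open>valuation_defining_all_sets\<close>). For such a valuation a Hennessy--Milner argument applies:
  inclusion between the sets of \<open>ES2\<close> formulas true at two worlds is itself a \<open>B\<close>-simulation
  (\<open>B_simulation_ES2_le\<close>). The key is that finitely many worlds can be excluded one by one, so that
  the worlds related to \<open>y\<close> are cut out by a single \<open>ES2\<close> formula \<open>A\<close>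
  (\<open>ES2_characteristic_formula\<close>). Now let \<open>x R y\<close>. The instance of the schema for this \<open>A\<close>, with \<open>C\<close>
  defining the successors of \<open>y\<close> and \<open>B\<close> saying \<open>\<not>\<box>C\<close> or not \<open>S x\<close>-above \<open>y\<close>, has a false
  conclusion at \<open>x\<close>, since \<open>y\<close> satisfies \<open>A \<and> \<box>C\<close> while nothing \<open>S x\<close>-above \<open>y\<close> satisfies
  \<open>B \<and> \<box>C\<close>. So \<open>A \<rhd> B\<close> fails at \<open>x\<close>, and the world witnessing this failure is the \<open>y'\<close> that the
  frame condition asks for.
\<close>

text \<open>Formulas \<open>\<box>A\<close> and \<open>\<not>\<box>A\<close> depend only on the successor set. For \<open>\<not>(A \<rhd> B)\<close>, a successor \<open>y\<close> of \<open>x\<close>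
  with \<open>A\<close> and no \<open>B\<close> above it is matched by some \<open>y'\<close>: \<open>A\<close> passes to \<open>y'\<close> by induction, and \<open>B\<close>
  stays unreachable because \<open>y'\<close> has no more \<open>S x'\<close>-successors than \<open>y\<close> has \<open>S x\<close>-successors.\<close>

lemma ES2_preserved_by_B_simulation:
  assumes "il_frame W R S" and Z: "B_simulation W R S Z"
    and "ES2 A" and "(x, x') \<in> Z" and "forces R S V x A"
  shows "forces R S V x' A"
  using \<open>ES2 A\<close> assms(4,5)
proof (induction arbitrary: x x')
  case (ES2_Box A)
  then have "R `` {x} = R `` {x'}" using Z unfolding B_simulation_def by blast
  with ES2_Box show ?case by auto
next
  case (ES2_NegBox A)
  then have "R `` {x} = R `` {x'}" using Z unfolding B_simulation_def by blast
  with ES2_NegBox show ?case by auto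
next
  case (ES2_And A B)
  then show ?case by auto
next
  case (ES2_Or A B)
  then show ?case by auto
next
  case (ES2_NegRhd A B)
  interpret il_frame W R S by fact
  have "x \<in> W" and up: "R `` {x} = R `` {x'}"
    using Z ES2_NegRhd.prems(1) unfolding B_simulation_def by blast+
  obtain y where y: "(x, y) \<in> R" "forces R S V y A"
    and noB: "\<And>v. (y, v) \<in> S x \<Longrightarrow> \<not> forces R S V v B"
    using ES2_NegRhd.prems(2) by auto
  obtain y' where y': "(y, y') \<in> S x" "(y, y') \<in> Z" "S x' `` {y'} \<subseteq> S x `` {y}"
    using Z ES2_NegRhd.prems(1) y(1) unfolding B_simulation_def by meson
  have "(x', y') \<in> R" using S_dom[OF \<open>x \<in> W\<close> y'(1)] up by blast
  moreover have "forces R S V y' A" using ES2_NegRhd.IH y'(2) y(2) .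
  moreover have "\<not> forces R S V v B" if "(y', v) \<in> S x'" for v
    using that y'(3) noB by blast
  ultimately show ?case by auto
qed

lemma frame_condition_B_imp_valid:
  assumes "il_frame W R S" and "frame_condition_B W R S" and "F \<in> schema_B"
  shows "frame_valid W R S F"
proof -
  interpret il_frame W R S by fact
  obtain A B C where F: "F = Imp (Rhd A B) (Rhd (And A (Box C)) (And B (Box C)))" and "ES2 A"
    using assms(3) unfolding schema_B_def by blast
  obtain Z where Z: "B_simulation W R S Z"
    and cond: "\<And>x y. x \<in> W \<Longrightarrow> y \<in> W \<Longrightarrow> (x, y) \<in> R \<Longrightarrow>
           \<exists>y'. (y, y') \<in> S x \<and> (y, y') \<in> Z \<and> (\<forall>d e. (y', d) \<in> S x \<and> (d, e) \<in> R \<longrightarrow> (y, e) \<in> R)"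
    using assms(2) unfolding frame_condition_B_def by blast
  have "\<exists>d. (y, d) \<in> S x \<and> forces R S V d (And B (Box C))"
    if "x \<in> W" and AB: "forces R S V x (Rhd A B)"
      and xy: "(x, y) \<in> R" and y: "forces R S V y A" "forces R S V y (Box C)" for V x y
  proof -
    have "y \<in> W" using xy R_carrier by blast
    then obtain y' where y': "(y, y') \<in> S x" "(y, y') \<in> Z"
      and sub: "\<And>d e. (y', d) \<in> S x \<Longrightarrow> (d, e) \<in> R \<Longrightarrow> (y, e) \<in> R"
      using cond[OF \<open>x \<in> W\<close> _ xy] by blast
    have "forces R S V y' A"
      using ES2_preserved_by_B_simulation[OF assms(1) Z \<open>ES2 A\<close> y'(2) y(1)] .
    moreover have "(x, y') \<in> R" using S_dom[OF \<open>x \<in> W\<close> y'(1)] by blast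
    ultimately obtain d where d: "(y', d) \<in> S x" "forces R S V d B"
      using AB by auto
    have "forces R S V d (Box C)" using sub[OF d(1)] y(2) by auto
    then show ?thesis using S_trans[OF \<open>x \<in> W\<close> y'(1) d(1)] d(2) by auto
  qed
  then show ?thesis unfolding F frame_valid_def by simp
qed

definition defines_all_sets ::
  "'w set \<Rightarrow> 'w rel \<Rightarrow> ('w \<Rightarrow> 'w rel) \<Rightarrow> ('w \<Rightarrow> nat \<Rightarrow> bool) \<Rightarrow> bool" where
  "defines_all_sets W R S V \<longleftrightarrow>
     (\<forall>X\<subseteq>W. \<exists>A. \<forall>w\<in>W. forces R S V w A \<longleftrightarrow> w \<in> X)"

text \<open>Each world gets a variable of its own; a set is then a finite disjunction of variables.\<close>

lemma valuation_defining_all_sets: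
  assumes "finite W"
  shows "\<exists>V. defines_all_sets W R S V"
proof -
  obtain f :: "_ \<Rightarrow> nat" where f: "inj_on f W"
    using finite_imp_inj_to_nat_seg[OF assms] by blast
  let ?V = "\<lambda>w p. f w = p"
  have "\<exists>A. \<forall>w\<in>W. forces R S ?V w A \<longleftrightarrow> w \<in> X" if "X \<subseteq> W" for X
    using finite_subset[OF that assms] that
  proof (induction rule: finite_induct)
    case empty
    then show ?case by (intro exI[of _ Bot]) simp
  next
    case (insert a X)
    then obtain A where A: "\<forall>w\<in>W. forces R S ?V w A \<longleftrightarrow> w \<in> X" by blast
    have "f w = f a \<longleftrightarrow> w = a" if "w \<in> W" for w
      using that insert.prems f by (auto dest: inj_onD)
    with A show ?case by (intro exI[of _ "Or (Var (f a)) A"]) auto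
  qed
  then show ?thesis unfolding defines_all_sets_def by blast
qed

definition ES2_le :: "'w set \<Rightarrow> 'w rel \<Rightarrow> ('w \<Rightarrow> 'w rel) \<Rightarrow> ('w \<Rightarrow> nat \<Rightarrow> bool) \<Rightarrow> 'w rel" where
  "ES2_le W R S V = {(x, x'). x \<in> W \<and> x' \<in> W \<and>
     (\<forall>A. ES2 A \<longrightarrow> forces R S V x A \<longrightarrow> forces R S V x' A)}"

text \<open>Every world that \<open>ES2_le\<close> does not relate to \<open>y\<close> is excluded by some \<open>ES2\<close> formula true at \<open>y\<close>; as there are only
  finitely many worlds, the conjunction of these formulas is again in \<open>ES2\<close>.\<close>

lemma ES2_characteristic_formula:
  assumes "finite W" and "y \<in> W"
  obtains A where "ES2 A" and "forces R S V y A"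
    and "\<And>u. u \<in> W \<Longrightarrow> forces R S V u A \<Longrightarrow> (y, u) \<in> ES2_le W R S V"
proof -
  have "\<exists>A. ES2 A \<and> forces R S V y A \<and>
          (\<forall>u\<in>U. forces R S V u A \<longrightarrow> (y, u) \<in> ES2_le W R S V)" if "U \<subseteq> W" for U
    using finite_subset[OF that assms(1)] that
  proof (induction rule: finite_induct)
    case empty
    \<comment> \<open>The grammar has no \<open>\<top>\<close>, but \<open>\<box>\<top>\<close> is true everywhere.\<close>
    show ?case by (intro exI[of _ "Box (Imp Bot Bot)"]) (simp add: ES2_Box)
  next
    case (insert u U)
    then obtain A where A: "ES2 A" "forces R S V y A"
      "\<forall>u\<in>U. forces R S V u A \<longrightarrow> (y, u) \<in> ES2_le W R S V" by blast
    show ?case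
    proof (cases "(y, u) \<in> ES2_le W R S V")
      case True
      with A show ?thesis by blast
    next
      case False
      then obtain D where "ES2 D" "forces R S V y D" "\<not> forces R S V u D"
        using insert.prems assms(2) unfolding ES2_le_def by blast
      with A show ?thesis by (intro exI[of _ "And A D"]) (auto intro: ES2_And)
    qed
  qed
  from this[OF subset_refl] that show ?thesis by blast
qed

text \<open>Equality of the successor sets is forced by \<open>\<box>\<close> and \<open>\<not>\<box>\<close> formulas about the definable set of
  successors. For the second clause, the move from \<open>x\<close> to \<open>y\<close> is recorded at \<open>x\<close> by the \<open>ES2\<close> formula
  \<open>\<not>(A \<rhd> B)\<close>, where \<open>A\<close> characterises \<open>y\<close> and \<open>B\<close> defines the complement of the worlds
  \<open>S x\<close>-above \<open>y\<close>; the formula then holds at \<open>x'\<close>, and its witness there is the matching move.\<close>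

lemma B_simulation_ES2_le:
  assumes "il_frame W R S" and "finite W" and V: "defines_all_sets W R S V"
  shows "B_simulation W R S (ES2_le W R S V)"
proof -
  interpret il_frame W R S by fact
  have definable: "\<exists>A. \<forall>w\<in>W. forces R S V w A \<longleftrightarrow> w \<in> X" if "X \<subseteq> W" for X
    using V that unfolding defines_all_sets_def by blast
  have up: "R `` {x} = R `` {x'}" if le: "(x, x') \<in> ES2_le W R S V" for x x'
  proof -
    have transfer: "forces R S V x' A" if "ES2 A" "forces R S V x A" for A
      using le that unfolding ES2_le_def by blast
    obtain A A' where A: "\<forall>w\<in>W. forces R S V w A \<longleftrightarrow> w \<in> R `` {x}"
      and A': "\<forall>w\<in>W. forces R S V w A' \<longleftrightarrow> w \<in> R `` {x'}"
      using definable R_carrier by (metis Image_subset)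
    have "forces R S V x (Box A)" using A R_carrier by auto
    then have "forces R S V x' (Box A)" using transfer ES2_Box by blast
    then have "R `` {x'} \<subseteq> R `` {x}" using A R_carrier by auto
    moreover have "\<not> forces R S V x' (Neg (Box A'))" using A' R_carrier by auto
    then have "\<not> forces R S V x (Neg (Box A'))" using transfer ES2_NegBox by blast
    then have "R `` {x} \<subseteq> R `` {x'}" using A' R_carrier by auto
    ultimately show ?thesis by blast
  qed
  have forth: "\<exists>y'. (y, y') \<in> S x \<and> (y, y') \<in> ES2_le W R S V \<and> S x' `` {y'} \<subseteq> S x `` {y}"
    if le: "(x, x') \<in> ES2_le W R S V" and xy: "(x, y) \<in> R" for x x' y
  proof -
    have W: "x \<in> W" "x' \<in> W" "y \<in> W" using le xy R_carrier unfolding ES2_le_def by blast+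
    obtain A where A: "ES2 A" "forces R S V y A"
      and char: "\<And>u. u \<in> W \<Longrightarrow> forces R S V u A \<Longrightarrow> (y, u) \<in> ES2_le W R S V"
      using ES2_characteristic_formula[OF \<open>finite W\<close> \<open>y \<in> W\<close>] by metis
    obtain B where B: "\<forall>w\<in>W. forces R S V w B \<longleftrightarrow> w \<in> W - S x `` {y}"
      using definable[of "W - S x `` {y}"] by blast
    have "forces R S V x (Neg (Rhd A B))"
      using xy A(2) B S_carrier[OF \<open>x \<in> W\<close>] by auto
    then have "forces R S V x' (Neg (Rhd A B))"
      using le ES2_NegRhd[OF A(1)] unfolding ES2_le_def by blast
    then obtain y' where y': "(x', y') \<in> R" "forces R S V y' A"
      and noB: "\<And>v. (y', v) \<in> S x' \<Longrightarrow> \<not> forces R S V v B"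
      by auto
    have "S x' `` {y'} \<subseteq> S x `` {y}"
      using noB B S_carrier[OF \<open>x' \<in> W\<close>] by blast
    moreover from this have "(y, y') \<in> S x" using S_refl[OF y'(1)] by blast
    moreover have "(y, y') \<in> ES2_le W R S V" using char y' R_carrier by blast
    ultimately show ?thesis by blast
  qed
  have "ES2_le W R S V \<subseteq> W \<times> W" unfolding ES2_le_def by blast
  with up forth show ?thesis unfolding B_simulation_def by meson
qed

lemma valid_imp_frame_condition_B:
  assumes "il_frame W R S" and "finite W" and valid: "\<forall>F\<in>schema_B. frame_valid W R S F"
  shows "frame_condition_B W R S"
proof -
  interpret il_frame W R S by fact
  obtain V where V: "defines_all_sets W R S V"
    using valuation_defining_all_sets[OF \<open>finite W\<close>] by blast
  have definable: "\<exists>A. \<forall>w\<in>W. forces R S V w A \<longleftrightarrow> w \<in> X" if "X \<subseteq> W" for X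
    using V that unfolding defines_all_sets_def by blast
  have "\<exists>y'. (y, y') \<in> S x \<and> (y, y') \<in> ES2_le W R S V \<and>
          (\<forall>d e. (y', d) \<in> S x \<and> (d, e) \<in> R \<longrightarrow> (y, e) \<in> R)"
    if "x \<in> W" "y \<in> W" and xy: "(x, y) \<in> R" for x y
  proof -
    obtain A where A: "ES2 A" "forces R S V y A"
      and char: "\<And>u. u \<in> W \<Longrightarrow> forces R S V u A \<Longrightarrow> (y, u) \<in> ES2_le W R S V"
      using ES2_characteristic_formula[OF \<open>finite W\<close> \<open>y \<in> W\<close>] by metis
    obtain C where C: "\<forall>w\<in>W. forces R S V w C \<longleftrightarrow> w \<in> R `` {y}"
      using definable[of "R `` {y}"] R_carrier by blast
    obtain D where D: "\<forall>w\<in>W. forces R S V w D \<longleftrightarrow> w \<in> W - S x `` {y}"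
      using definable[of "W - S x `` {y}"] by blast
    define B where "B = Or (Neg (Box C)) D"
    have "Imp (Rhd A B) (Rhd (And A (Box C)) (And B (Box C))) \<in> schema_B"
      using A(1) unfolding schema_B_def by blast
    then have inst: "forces R S V x (Imp (Rhd A B) (Rhd (And A (Box C)) (And B (Box C))))"
      using valid \<open>x \<in> W\<close> unfolding frame_valid_def by blast
    have "forces R S V y (Box C)" using C R_carrier by auto
    moreover have "\<not> forces R S V d (And B (Box C))" if "(y, d) \<in> S x" for d
      using that D S_carrier[OF \<open>x \<in> W\<close>] unfolding B_def by auto
    ultimately have "\<not> forces R S V x (Rhd (And A (Box C)) (And B (Box C)))"
      using xy A(2) by (meson forces.simps(3,6))
    then have "\<not> forces R S V x (Rhd A B)" using inst by (meson forces.simps(4))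
    then obtain y' where y': "(x, y') \<in> R" "forces R S V y' A"
      and noB: "\<And>d. (y', d) \<in> S x \<Longrightarrow> \<not> forces R S V d B"
      by auto
    have "y' \<in> W" using y'(1) R_carrier by blast
    \<comment> \<open>The disjunct \<open>D\<close> of \<open>B\<close>, tested at \<open>y'\<close> itself, is what places \<open>y'\<close> above \<open>y\<close>.\<close>
    have "\<not> forces R S V y' D" using noB[OF S_refl[OF y'(1)]] unfolding B_def by simp
    then have "(y, y') \<in> S x" using D \<open>y' \<in> W\<close> by blast
    moreover have "(y, y') \<in> ES2_le W R S V" using char \<open>y' \<in> W\<close> y'(2) .
    moreover have "(y, e) \<in> R" if "(y', d) \<in> S x" "(d, e) \<in> R" for d e
    proof -
      have "forces R S V d (Box C)" using noB[OF that(1)] unfolding B_def by auto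
      then show ?thesis using that(2) C R_carrier by auto
    qed
    ultimately show ?thesis by blast
  qed
  then show ?thesis
    unfolding frame_condition_B_def
    using B_simulation_ES2_le[OF assms(1,2) V] by blast
qed

theorem theorem6p14:
  fixes W :: "'w set" and R :: "'w rel" and S :: "'w \<Rightarrow> 'w rel"
  assumes "il_frame W R S" and "finite W"
  shows "(\<forall>A\<in>schema_B. frame_valid W R S A) \<longleftrightarrow> frame_condition_B W R S"
  using assms valid_imp_frame_condition_B frame_condition_B_imp_valid by blast

end
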